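(* Let $X\subseteq\mathbb{R}^n$ be a polyhedral set. Let $$\psi(x)=\max_{1\le i\le k_1}\psi_{1i}(x)-\max_{1\le j\le k_2}\psi_{2j}(x),$$ where all $\psi_{1i}$ and $\psi_{2j}$ are quadratic functions on $\mathbb{R}^n$. Then the problem $\min_{x\in X}\psi(x)$ has only finitely many d-stationary values on $$\widetilde{\mathcal{D}}=\left\{\bar x\in\mathcal{D}_{(\psi,X)} \;\middle|\; \left|\operatorname{argmax}_{1\le i\le k_1}\psi_{1i}(\bar x)\right|\le 2\right\};$$ that is, the set $\psi(\widetilde{\mathcal{D}})$ is finite.
   Context: A polyhedral set is a set of the form $\{x\in\mathbb{R}^n : Ax\le b\}$. A quadratic function is a polynomial of degree at most two (its Hessian may be indefinite or zero). Directional derivative: $\psi'(\bar x;v)=\lim_{\delta\downarrow 0}\frac{\psi(\bar x+\delta v)-\psi(\bar x)}{\delta}$. A point $\bar x\in X$ is a d-stationary point of $\min_{x\in X}\psi(x)$ if $\psi'(\bar x;x-\bar x)\ge 0$ for all $x\in X$; $\mathcal{D}_{(\psi,X)}$ denotes the set of all such points, and the numbers $\psi(\bar x)$ for $\bar x\in\mathcal{D}_{(\psi,X)}$ are the d-stationary values. $\operatorname{argmax}_{1\le i\le k_1}\psi_{1i}(\bar x)$ is the set of indices $i$ attaining the maximum at $\bar x$, and $|\cdot|$ denotes its cardinality. *)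

theory Defs
  imports "HOL-Analysis.Analysis"
begin

(* The library's polyhedron asks for nonzero normal vectors; zero rows of A add nothing,
   because they contribute only UNIV or the empty set. *)
lemma polyhedron_iff_linear_system:
  fixes X :: "(real ^ 'n) set"
  shows "polyhedron X \<longleftrightarrow>
    (\<exists>(m::nat) (a :: nat \<Rightarrow> real ^ 'n) b. X = {x. \<forall>i<m. a i \<bullet> x \<le> b i})"
proof
  assume "polyhedron X"
  then obtain F where F: "finite F" "X = \<Inter>F"
    and H: "\<And>h. h \<in> F \<Longrightarrow> \<exists>a b. a \<noteq> 0 \<and> h = {x. a \<bullet> x \<le> b}"
    unfolding polyhedron_def by blast
  from H obtain a b where ab: "\<And>h. h \<in> F \<Longrightarrow> h = {x. a h \<bullet> x \<le> b h}" by metis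
  obtain m :: nat and g where g: "F = g ` {i. i < m}"
    using F(1) finite_imp_nat_seg_image_inj_on by metis
  have "X = {x. \<forall>i<m. a (g i) \<bullet> x \<le> b (g i)}"
    using ab unfolding F(2) g by fastforce
  then show "\<exists>(m::nat) a b. X = {x. \<forall>i<m. a i \<bullet> x \<le> b i}"
    by (intro exI[of _ m] exI[of _ "\<lambda>i. a (g i)"] exI[of _ "\<lambda>i. b (g i)"])
next
  assume "\<exists>(m::nat) (a :: nat \<Rightarrow> real ^ 'n) b. X = {x. \<forall>i<m. a i \<bullet> x \<le> b i}"
  then obtain m :: nat and a b where X: "X = (\<Inter>i\<in>{..<m}. {x. a i \<bullet> x \<le> b i})"
    by auto
  have "polyhedron {x. c \<bullet> x \<le> d}" for c :: "real ^ 'n" and d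
    by (rule polyhedron_halfspace_le)
  then show "polyhedron X"
    unfolding X by (intro polyhedron_Inter) auto
qed

definition quadratic_function :: "(real ^ 'n \<Rightarrow> real) \<Rightarrow> bool" where
  "quadratic_function f \<longleftrightarrow>
    (\<exists>(Q :: real ^ 'n ^ 'n) (c :: real ^ 'n) (d :: real).
      \<forall>x. f x = (\<Sum>i\<in>UNIV. \<Sum>j\<in>UNIV. Q $ i $ j * x $ i * x $ j) + (\<Sum>i\<in>UNIV. c $ i * x $ i) + d)"

definition has_dir_derivative ::
  "('a :: real_normed_vector \<Rightarrow> real) \<Rightarrow> real \<Rightarrow> 'a \<Rightarrow> 'a \<Rightarrow> bool" where
  "has_dir_derivative \<psi> L x v \<longleftrightarrow>
    ((\<lambda>\<delta>. (\<psi> (x + \<delta> *\<^sub>R v) - \<psi> x) / \<delta>) \<longlongrightarrow> L) (at_right 0)"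

(* Existence of the directional derivatives is part of stationarity, so that no unspecified
   limit value can enter. *)
definition d_stationary_points ::
  "('a :: real_normed_vector \<Rightarrow> real) \<Rightarrow> 'a set \<Rightarrow> 'a set" where
  "d_stationary_points \<psi> X =
    {x \<in> X. \<forall>y\<in>X. \<exists>L. has_dir_derivative \<psi> L x (y - x) \<and> L \<ge> 0}"

definition argmax_set :: "('i \<Rightarrow> real) \<Rightarrow> 'i set \<Rightarrow> 'i set" where
  "argmax_set f I = {i. is_arg_max f (\<lambda>i. i \<in> I) i}"

end

theory Submission
  imports Defs "HOL-Computational_Algebra.Polynomial"
begin

text \<open>
  Let \<open>x\<close> be a d-stationary point at which \<open>\<psi>1 i\<close> and \<open>\<psi>1 i'\<close> (possibly \<open>i = i'\<close>) are the
  active pieces of the first maximum, let \<open>\<psi>2 j\<close> be active in the second one, and let \<open>I\<close> be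
  the set of linear constraints that are tight at \<open>x\<close>. Near \<open>x\<close> the function \<open>\<psi>\<close> lies below
  \<open>max q1 q2\<close> with \<open>q1 = \<psi>1 i - \<psi>2 j\<close> and \<open>q2 = \<psi>1 i' - \<psi>2 j\<close>, with equality at \<open>x\<close>. Hence
  this maximum does not decrease to first order along any direction of the subspace \<open>V\<close> on
  which the tight constraints vanish, and so an affine combination of the two gradients at \<open>x\<close>
  is orthogonal to \<open>V\<close> (\<open>d_stationary_imp_pencil_critical\<close>). Thus \<open>x\<close> is critical, on the
  affine set cut out by \<open>I\<close>, for a member \<open>t q1 + (1 - t) q2\<close> of the pencil of \<open>q1\<close> and \<open>q2\<close>,
  and \<open>\<psi> x = q1 x = q2 x\<close>. There are finitely many choices of \<open>(I, i, i', j)\<close>, so it suffices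
  to bound the values that one pencil can contribute (\<open>finite_pencil_critical_values\<close>).

  For fixed \<open>t\<close> a quadratic function takes one value \<open>g t\<close> on all its critical points in an
  affine set, so only infinitely many parameters \<open>t\<close> could do harm. Criticality is a linear
  system in \<open>x\<close> with coefficients polynomial in \<open>t\<close>. Gaussian elimination over the rational
  functions parametrizes its solutions rationally in \<open>t\<close>, up to finitely many exceptional \<open>t\<close>
  (\<open>solution_set_parametrization\<close>). Two things follow: \<open>g\<close> is a rational function, and through
  every critical point \<open>x\<close> of a non-exceptional parameter \<open>s\<close> runs a differentiable curve of
  critical points. Differentiating along that curve, only the explicit dependence on \<open>t\<close>
  survives: \<open>g' s = q1 x - q2 x\<close>. This is zero when \<open>q1 x = q2 x\<close>. A rational function
  with infinitely many critical points is constant, so either finitely many \<open>t\<close> matter or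
  \<open>g\<close> is constant up to finitely many \<open>t\<close>. In both cases finitely many values remain.
\<close>

section \<open>Functions that are rational up to finitely many points\<close>

text \<open>
  Rational functions of one real variable, with arbitrary values at finitely many points. This
  makes the class closed under division without a discussion of poles.
\<close>

definition almost_rational :: "(real \<Rightarrow> real) \<Rightarrow> bool" where
  "almost_rational f \<longleftrightarrow>
    (\<exists>p q. q \<noteq> 0 \<and> (\<forall>\<^sub>F t in cofinite. f t = poly p t / poly q t))"

lemma eventually_poly_nonzero:
  fixes q :: "real poly"
  assumes "q \<noteq> 0"
  shows "\<forall>\<^sub>F t in cofinite. poly q t \<noteq> 0"
  using poly_roots_finite[OF assms] by (simp add: eventually_cofinite)

lemma eventually_cofinite_at:
  fixes s :: "'a :: t1_space"
  assumes "\<forall>\<^sub>F t in cofinite. P t"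
  shows "\<forall>\<^sub>F t in at s. P t"
proof -
  have "finite {t. \<not> P t}" using assms by (simp add: eventually_cofinite)
  then have "open (- ({t. \<not> P t} - {s}))" by (intro open_Compl finite_imp_closed) auto
  then show ?thesis
    unfolding eventually_at_topological by (intro exI[of _ "- ({t. \<not> P t} - {s})"]) auto
qed

lemma almost_rational_cong:
  assumes "almost_rational f" and g: "\<forall>\<^sub>F t in cofinite. g t = f t"
  shows "almost_rational g"
proof -
  from assms(1) obtain p q where "q \<noteq> 0" "\<forall>\<^sub>F t in cofinite. f t = poly p t / poly q t"
    unfolding almost_rational_def by blast
  moreover from g this(2) have "\<forall>\<^sub>F t in cofinite. g t = poly p t / poly q t"
    by eventually_elim simp
  ultimately show ?thesis unfolding almost_rational_def by blast
qed

lemma almost_rational_const [simp]: "almost_rational (\<lambda>_. c)"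
  unfolding almost_rational_def by (intro exI[of _ "[:c:]"] exI[of _ 1]) simp

lemma almost_rational_ident [simp]: "almost_rational (\<lambda>t. t)"
  unfolding almost_rational_def by (intro exI[of _ "[:0, 1:]"] exI[of _ 1]) simp

lemma almost_rational_add:
  assumes "almost_rational f" "almost_rational g"
  shows "almost_rational (\<lambda>t. f t + g t)"
proof -
  from assms obtain p q p' q' where q: "q \<noteq> 0" "q' \<noteq> 0"
    and ev: "\<forall>\<^sub>F t in cofinite. f t = poly p t / poly q t"
            "\<forall>\<^sub>F t in cofinite. g t = poly p' t / poly q' t"
    unfolding almost_rational_def by blast
  have "\<forall>\<^sub>F t in cofinite. f t + g t = poly (p * q' + p' * q) t / poly (q * q') t"
    using ev q[THEN eventually_poly_nonzero]
    by eventually_elim (simp add: field_simps)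
  with q show ?thesis unfolding almost_rational_def
    by (intro exI[of _ "p * q' + p' * q"] exI[of _ "q * q'"]) simp
qed

lemma almost_rational_mult:
  assumes "almost_rational f" "almost_rational g"
  shows "almost_rational (\<lambda>t. f t * g t)"
proof -
  from assms obtain p q p' q' where q: "q \<noteq> 0" "q' \<noteq> 0"
    and ev: "\<forall>\<^sub>F t in cofinite. f t = poly p t / poly q t"
            "\<forall>\<^sub>F t in cofinite. g t = poly p' t / poly q' t"
    unfolding almost_rational_def by blast
  have "\<forall>\<^sub>F t in cofinite. f t * g t = poly (p * p') t / poly (q * q') t"
    using ev by eventually_elim simp
  with q show ?thesis unfolding almost_rational_def
    by (intro exI[of _ "p * p'"] exI[of _ "q * q'"]) simp
qed

text \<open>
  Rational functions form a field: a coefficient is zero as a rational function or may be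
  divided by, at all but finitely many parameters. Elimination branches on this dichotomy.
\<close>

lemma almost_rational_zero_or_nonzero:
  assumes "almost_rational f"
  shows "(\<forall>\<^sub>F t in cofinite. f t = 0) \<or> (\<forall>\<^sub>F t in cofinite. f t \<noteq> 0)"
proof -
  from assms obtain p q where q: "q \<noteq> 0"
    and ev: "\<forall>\<^sub>F t in cofinite. f t = poly p t / poly q t"
    unfolding almost_rational_def by blast
  show ?thesis
  proof (cases "p = 0")
    case True
    then show ?thesis using ev by (auto elim: eventually_mono)
  next
    case False
    have "\<forall>\<^sub>F t in cofinite. f t \<noteq> 0"
      using ev eventually_poly_nonzero[OF q] eventually_poly_nonzero[OF False]
      by eventually_elim simp
    then show ?thesis ..
  qed
qed

lemma almost_rational_inverse:
  assumes "almost_rational f"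
  shows "almost_rational (\<lambda>t. inverse (f t))"
proof -
  from assms obtain p q where q: "q \<noteq> 0"
    and ev: "\<forall>\<^sub>F t in cofinite. f t = poly p t / poly q t"
    unfolding almost_rational_def by blast
  show ?thesis
  proof (cases "p = 0")
    case True
    then have "\<forall>\<^sub>F t in cofinite. inverse (f t) = poly 0 t / poly 1 t"
      using ev by (auto elim: eventually_mono)
    then show ?thesis unfolding almost_rational_def by (metis one_neq_zero)
  next
    case False
    have "\<forall>\<^sub>F t in cofinite. inverse (f t) = poly q t / poly p t"
      using ev by eventually_elim simp
    with False show ?thesis unfolding almost_rational_def by blast
  qed
qed

lemma almost_rational_diff:
  assumes "almost_rational f" "almost_rational g"
  shows "almost_rational (\<lambda>t. f t - g t)"
  using almost_rational_add[OF assms(1) almost_rational_mult[OF almost_rational_const[of "-1"] assms(2)]]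
  by simp

lemma almost_rational_divide:
  assumes "almost_rational f" "almost_rational g"
  shows "almost_rational (\<lambda>t. f t / g t)"
  using almost_rational_mult[OF assms(1) almost_rational_inverse[OF assms(2)]]
  by (simp add: divide_inverse)

lemma almost_rational_sum:
  assumes "\<And>i. i \<in> A \<Longrightarrow> almost_rational (f i)"
  shows "almost_rational (\<lambda>t. \<Sum>i\<in>A. f i t)"
  using assms
proof (induction A rule: infinite_finite_induct)
  case (insert x A)
  then show ?case by (simp add: almost_rational_add)
qed simp_all

lemmas almost_rational_intros =
  almost_rational_const almost_rational_ident almost_rational_add almost_rational_diff
  almost_rational_mult almost_rational_divide almost_rational_sum

lemma almost_rational_inner:
  fixes u v :: "real \<Rightarrow> real ^ 'n"
  assumes "\<And>k. almost_rational (\<lambda>t. u t $ k)" "\<And>k. almost_rational (\<lambda>t. v t $ k)"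
  shows "almost_rational (\<lambda>t. u t \<bullet> v t)"
  unfolding inner_vec_def inner_real_def using assms by (intro almost_rational_intros)

lemma almost_rational_has_derivative:
  assumes "q \<noteq> 0" "\<forall>\<^sub>F t in cofinite. f t = poly p t / poly q t"
  shows "\<forall>\<^sub>F s in cofinite.
    (f has_real_derivative poly (pderiv p * q - p * pderiv q) s / (poly q s)\<^sup>2) (at s)"
  using assms(2) eventually_poly_nonzero[OF assms(1)]
proof eventually_elim
  case (elim s)
  have "((\<lambda>t. poly p t / poly q t) has_real_derivative
      poly (pderiv p * q - p * pderiv q) s / (poly q s)\<^sup>2) (at s)"
    using elim(2) by (auto intro!: derivative_eq_intros simp: power2_eq_square)
  then show ?case
    using has_field_derivative_cong_eventually[OF eventually_cofinite_at[OF assms(2)] elim(1)]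
    by blast
qed

lemma almost_rational_differentiable:
  assumes "almost_rational f"
  shows "\<forall>\<^sub>F s in cofinite. f differentiable (at s)"
proof -
  from assms obtain p q where "q \<noteq> 0" "\<forall>\<^sub>F t in cofinite. f t = poly p t / poly q t"
    unfolding almost_rational_def by blast
  from almost_rational_has_derivative[OF this] show ?thesis
    by eventually_elim (auto simp: real_differentiable_def)
qed

text \<open>
  The derivative of \<open>p / q\<close> has numerator \<open>p' q - p q'\<close>, a polynomial, which vanishes identically
  once it has infinitely many roots. Then \<open>p / q\<close> is a constant \<open>c\<close> on some interval without
  poles, and \<open>p - c q\<close> vanishes on that interval and therefore identically. The passage
  through the polynomial is what joins the components of the domain between the poles.
\<close>

lemma almost_rational_constant:
  assumes "almost_rational f" and inf: "infinite {s. (f has_real_derivative 0) (at s)}"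
  shows "\<exists>c. \<forall>\<^sub>F t in cofinite. f t = c"
proof -
  from assms obtain p q where q: "q \<noteq> 0"
    and f: "\<forall>\<^sub>F t in cofinite. f t = poly p t / poly q t"
    unfolding almost_rational_def by blast
  define w where "w = pderiv p * q - p * pderiv q"
  have der: "\<forall>\<^sub>F s in cofinite. (f has_real_derivative poly w s / (poly q s)\<^sup>2) (at s)"
    unfolding w_def by (rule almost_rational_has_derivative[OF q f])
  have "w = 0"
  proof (rule ccontr)
    assume "w \<noteq> 0"
    have "\<forall>\<^sub>F s in cofinite. \<not> (f has_real_derivative 0) (at s)"
      using der eventually_poly_nonzero[OF \<open>w \<noteq> 0\<close>] eventually_poly_nonzero[OF q]
      by eventually_elim (use \<open>w \<noteq> 0\<close> in \<open>auto dest: DERIV_unique\<close>)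
    with inf show False by (simp add: eventually_cofinite)
  qed
  define E where "E = {t. \<not> (f t = poly p t / poly q t \<and> poly q t \<noteq> 0
                            \<and> (f has_real_derivative 0) (at t))}"
  have "\<forall>\<^sub>F t in cofinite. f t = poly p t / poly q t \<and> poly q t \<noteq> 0
                            \<and> (f has_real_derivative 0) (at t)"
    using f der eventually_poly_nonzero[OF q] \<open>w = 0\<close> by (auto intro: eventually_conj)
  then have finE: "finite E" by (simp add: E_def eventually_cofinite)
  then obtain s where s: "s \<notin> E" using ex_new_if_finite infinite_UNIV_char_0 by blast
  have "open (- E)" using finE by (intro open_Compl finite_imp_closed)
  with s obtain e where e: "e > 0" "ball s e \<subseteq> - E"
    by (metis ComplI open_contains_ball)
  have "\<exists>c. \<forall>t\<in>ball s e. f t = c"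
  proof (rule has_field_derivative_zero_constant)
    fix t assume "t \<in> ball s e"
    with e have "(f has_real_derivative 0) (at t)" unfolding E_def by auto
    then show "(f has_real_derivative 0) (at t within ball s e)"
      by (rule has_field_derivative_at_within)
  qed simp
  then obtain c where c: "\<And>t. t \<in> ball s e \<Longrightarrow> f t = c" by blast
  have "p - smult c q = 0"
  proof (rule ccontr)
    assume "p - smult c q \<noteq> 0"
    then have "finite {t. poly (p - smult c q) t = 0}" by (rule poly_roots_finite)
    moreover have "ball s e \<subseteq> {t. poly (p - smult c q) t = 0}"
    proof
      fix t assume t: "t \<in> ball s e"
      then have "poly p t / poly q t = c" "poly q t \<noteq> 0" using c[OF t] e unfolding E_def by auto
      then show "t \<in> {t. poly (p - smult c q) t = 0}" by (simp add: field_simps)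
    qed
    moreover have "infinite (ball s e)"
      using e(1) by (simp add: ball_eq_greaterThanLessThan infinite_Ioo)
    ultimately show False using finite_subset by blast
  qed
  then have pq: "p = smult c q" by simp
  have "\<forall>\<^sub>F t in cofinite. f t = c"
    using f eventually_poly_nonzero[OF q] by eventually_elim (simp add: pq)
  then show ?thesis ..
qed

section \<open>Linear systems with rational coefficients\<close>

text \<open>
  Gaussian elimination, one equation at a time. On the solutions \<open>w t + P t *v z\<close> of the earlier
  equations, a new equation reads \<open>r t \<bullet> z = \<beta> t\<close>. If \<open>r\<close> is zero as a rational function,
  then the equation holds for all \<open>z\<close> or for none, for all but finitely many \<open>t\<close>. Otherwise
  some component \<open>r t $ k\<close> serves as a pivot, and correcting \<open>z\<close> in its \<open>k\<close>-th component turns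
  a free \<open>z\<close> into a solution.

  The number of parameters \<open>z\<close> is not reduced. The parametrization is in general not injective,
  and there is no bookkeeping of the remaining free variables.
\<close>

lemma solution_set_parametrization:
  fixes E :: "((real \<Rightarrow> real ^ 'n) \<times> (real \<Rightarrow> real)) set"
  assumes "finite E"
    and "\<And>a b k. (a, b) \<in> E \<Longrightarrow> almost_rational (\<lambda>t. a t $ k)"
    and "\<And>a b. (a, b) \<in> E \<Longrightarrow> almost_rational b"
  shows "(\<forall>\<^sub>F t in cofinite. {x. \<forall>(a, b)\<in>E. a t \<bullet> x = b t} = {}) \<or>
    (\<exists>(w :: real \<Rightarrow> real ^ 'n) (P :: real \<Rightarrow> real ^ 'n ^ 'n).
      (\<forall>i. almost_rational (\<lambda>t. w t $ i)) \<and> (\<forall>i k. almost_rational (\<lambda>t. P t $ i $ k)) \<and>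
      (\<forall>\<^sub>F t in cofinite. {x. \<forall>(a, b)\<in>E. a t \<bullet> x = b t} = range (\<lambda>z. w t + P t *v z)))"
  using assms
proof (induction E rule: finite_induct)
  case empty
  have "almost_rational (\<lambda>t. (mat 1 :: real ^ 'n ^ 'n) $ i $ k)" for i k by simp
  then show ?case
    by (intro disjI2 exI[of _ "\<lambda>_. 0"] exI[of _ "\<lambda>_. mat 1"]) auto
next
  case (insert e E)
  obtain a b where e: "e = (a, b)" by (cases e)
  have a: "almost_rational (\<lambda>t. a t $ k)" for k using insert.prems(1)[of a b k] e by simp
  have b: "almost_rational b" using insert.prems(2)[of a b] e by simp
  let ?S = "\<lambda>E t. {x. \<forall>(a, b)\<in>E. a t \<bullet> x = b t}"
  have S: "?S (insert e E) t = {x \<in> ?S E t. a t \<bullet> x = b t}" for t by (auto simp: e)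
  have "(\<forall>\<^sub>F t in cofinite. ?S E t = {}) \<or>
    (\<exists>(w :: real \<Rightarrow> real ^ 'n) (P :: real \<Rightarrow> real ^ 'n ^ 'n).
      (\<forall>i. almost_rational (\<lambda>t. w t $ i)) \<and> (\<forall>i k. almost_rational (\<lambda>t. P t $ i $ k)) \<and>
      (\<forall>\<^sub>F t in cofinite. ?S E t = range (\<lambda>z. w t + P t *v z)))"
    by (rule insert.IH) (use insert.prems in \<open>meson insertI2\<close>)+
  then consider (none) "\<forall>\<^sub>F t in cofinite. ?S E t = {}"
    | (par) w and P :: "real \<Rightarrow> real ^ 'n ^ 'n"
      where "\<And>i. almost_rational (\<lambda>t. w t $ i)" "\<And>i k. almost_rational (\<lambda>t. P t $ i $ k)"
        "\<forall>\<^sub>F t in cofinite. ?S E t = range (\<lambda>z. w t + P t *v z)"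
    by blast
  then show ?case
  proof cases
    case none
    have "\<forall>\<^sub>F t in cofinite. ?S (insert e E) t = {}"
      using none by eventually_elim (auto simp: S)
    then show ?thesis ..
  next
    case par
    \<comment> \<open>the new equation in the coordinates \<open>z\<close>\<close>
    define r where "r = (\<lambda>t. transpose (P t) *v a t)"
    define \<beta> where "\<beta> = (\<lambda>t. b t - a t \<bullet> w t)"
    have r_rat: "almost_rational (\<lambda>t. r t $ k)" for k
      unfolding r_def matrix_vector_mult_def transpose_def vec_lambda_beta
      by (intro almost_rational_intros a par)
    have \<beta>_rat: "almost_rational \<beta>"
      unfolding \<beta>_def by (intro almost_rational_intros almost_rational_inner a b par)
    have eqn: "a t \<bullet> (w t + P t *v z) = b t \<longleftrightarrow> r t \<bullet> z = \<beta> t" for t z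
      unfolding r_def \<beta>_def transpose_matrix_vector dot_lmul_matrix
      by (auto simp: inner_add_right)
    show ?thesis
    proof (cases "\<exists>k. \<forall>\<^sub>F t in cofinite. r t $ k \<noteq> 0")
      case False
      then have "\<forall>\<^sub>F t in cofinite. r t $ k = 0" for k
        using almost_rational_zero_or_nonzero[OF r_rat] by blast
      then have r0: "\<forall>\<^sub>F t in cofinite. r t = 0"
        unfolding vec_eq_iff zero_index by (intro eventually_all_finite) auto
      from almost_rational_zero_or_nonzero[OF \<beta>_rat] show ?thesis
      proof
        assume "\<forall>\<^sub>F t in cofinite. \<beta> t = 0"
        then have "\<forall>\<^sub>F t in cofinite. ?S (insert e E) t = range (\<lambda>z. w t + P t *v z)"
          using r0 par(3)
        proof eventually_elim
          case (elim t)
          then show ?case unfolding S using eqn[of t] by auto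
        qed
        with par show ?thesis by blast
      next
        assume "\<forall>\<^sub>F t in cofinite. \<beta> t \<noteq> 0"
        then have "\<forall>\<^sub>F t in cofinite. ?S (insert e E) t = {}"
          using r0 par(3)
        proof eventually_elim
          case (elim t)
          then show ?case unfolding S using eqn[of t] by auto
        qed
        then show ?thesis ..
      qed
    next
      case True
      then obtain k where k: "\<forall>\<^sub>F t in cofinite. r t $ k \<noteq> 0" ..
      \<comment> \<open>substitute \<open>z + ((\<beta> t - r t \<bullet> z) / r t $ k) e\<^sub>k\<close> for \<open>z\<close>; this is the identity on solutions \<open>z\<close>, so no solution is lost\<close>
      define w' where "w' = (\<lambda>t. w t + (\<beta> t / r t $ k) *\<^sub>R column k (P t))"
      define P' where "P' = (\<lambda>t. (\<chi> i j. P t $ i $ j - P t $ i $ k * r t $ j / r t $ k) :: real ^ 'n ^ 'n)"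
      have w'_rat: "almost_rational (\<lambda>t. w' t $ i)" for i
        unfolding w'_def column_def
        by (simp, intro almost_rational_intros par r_rat \<beta>_rat)
      have P'_rat: "almost_rational (\<lambda>t. P' t $ i $ j)" for i j
        unfolding P'_def vec_lambda_beta by (intro almost_rational_intros par r_rat)
      have new: "w' t + P' t *v z =
          w t + P t *v (z + ((\<beta> t - r t \<bullet> z) / r t $ k) *\<^sub>R axis k 1)" for t z
      proof -
        have "P' t *v z = P t *v z - ((r t \<bullet> z) / r t $ k) *\<^sub>R column k (P t)"
          unfolding P'_def
          by (simp add: vec_eq_iff matrix_vector_mult_def column_def inner_vec_def
              left_diff_distrib right_diff_distrib sum_subtractf sum_divide_distrib sum_distrib_left
              sum_distrib_right mult.commute mult.left_commute)
        moreover have "P t *v (z + ((\<beta> t - r t \<bullet> z) / r t $ k) *\<^sub>R axis k 1) =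
            P t *v z + ((\<beta> t - r t \<bullet> z) / r t $ k) *\<^sub>R column k (P t)"
          by (simp add: matrix_vector_right_distrib matrix_vector_mult_scaleR
              matrix_vector_mult_basis)
        ultimately show ?thesis
          unfolding w'_def by (simp add: diff_divide_distrib scaleR_left_diff_distrib)
      qed
      have "\<forall>\<^sub>F t in cofinite. ?S (insert e E) t = range (\<lambda>z. w' t + P' t *v z)"
        using k par(3)
      proof eventually_elim
        case (elim t)
        show ?case
        proof (intro equalityI subsetI)
          fix x assume "x \<in> ?S (insert e E) t"
          then obtain z where x: "x = w t + P t *v z" and "r t \<bullet> z = \<beta> t"
            unfolding S elim(2) using eqn by auto
          then have "x = w' t + P' t *v z" unfolding new by simp
          then show "x \<in> range (\<lambda>z. w' t + P' t *v z)" by blast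
        next
          fix x assume "x \<in> range (\<lambda>z. w' t + P' t *v z)"
          then obtain z where "x = w' t + P' t *v z" by blast
          then obtain y where x: "x = w t + P t *v y"
            and y: "y = z + ((\<beta> t - r t \<bullet> z) / r t $ k) *\<^sub>R axis k 1"
            unfolding new by blast
          have "r t \<bullet> y = \<beta> t"
            using elim(1) unfolding y by (simp add: inner_add_right inner_axis)
          then show "x \<in> ?S (insert e E) t"
            unfolding S elim(2) using eqn x by auto
        qed
      qed
      with w'_rat P'_rat show ?thesis by blast
    qed
  qed
qed

section \<open>Quadratic functions\<close>

text \<open>
  The factor one half makes \<open>H *v x + c\<close> the gradient at \<open>x\<close> when \<open>H\<close> is symmetric.
\<close>

definition quad :: "real ^ 'n ^ 'n \<Rightarrow> real ^ 'n \<Rightarrow> real \<Rightarrow> real ^ 'n \<Rightarrow> real" where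
  "quad H c d x = x \<bullet> (H *v x) / 2 + c \<bullet> x + d"

lemma transpose_add: "transpose (A + B) = transpose A + transpose (B :: real ^ 'n ^ 'm)"
  by (simp add: transpose_def vec_eq_iff)

lemma transpose_diff: "transpose (A - B) = transpose A - transpose (B :: real ^ 'n ^ 'm)"
  by (simp add: transpose_def vec_eq_iff)

lemma symmetric_inner_commute:
  fixes H :: "real ^ 'n ^ 'n"
  assumes "transpose H = H"
  shows "x \<bullet> (H *v y) = (H *v x) \<bullet> y"
  by (metis assms dot_lmul_matrix transpose_matrix_vector)

lemma quadratic_function_imp_quad:
  assumes "quadratic_function f"
  shows "\<exists>H c d. transpose H = H \<and> f = quad H c d"
proof -
  from assms obtain Q c d where f: "\<And>x. f x =
      (\<Sum>i\<in>UNIV. \<Sum>j\<in>UNIV. Q $ i $ j * x $ i * x $ j) + (\<Sum>i\<in>UNIV. c $ i * x $ i) + d"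
    unfolding quadratic_function_def by blast
  have "f x = quad (Q + transpose Q) c d x" for x
  proof -
    have "x \<bullet> (transpose Q *v x) = x \<bullet> (Q *v x)"
      by (metis dot_lmul_matrix inner_commute transpose_matrix_vector)
    moreover have "x \<bullet> (Q *v x) = (\<Sum>i\<in>UNIV. \<Sum>j\<in>UNIV. Q $ i $ j * x $ i * x $ j)"
      by (simp add: inner_vec_def matrix_vector_mult_def sum_distrib_left mult_ac)
    ultimately show ?thesis
      unfolding f quad_def
      by (simp add: matrix_vector_mult_add_rdistrib inner_add_right inner_vec_def[of c])
  qed
  moreover have "transpose (Q + transpose Q) = Q + transpose Q"
    by (simp add: transpose_add add.commute)
  ultimately show ?thesis by blast
qed

lemma quad_expand:
  assumes "transpose H = H"
  shows "quad H c d (x + v) = quad H c d x + (H *v x + c) \<bullet> v + v \<bullet> (H *v v) / 2"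
  using symmetric_inner_commute[OF assms, of v x] symmetric_inner_commute[OF assms, of x v]
  by (simp add: quad_def matrix_vector_right_distrib inner_add_right inner_add_left
      inner_commute field_simps)

lemma quad_diff: "quad H c d x - quad H' c' d' x = quad (H - H') (c - c') (d - d') x"
  by (simp add: quad_def matrix_vector_mult_diff_rdistrib inner_diff_right inner_diff_left
      field_simps)

lemma quad_pencil:
  "t * quad H c d x + (1 - t) * quad H' c' d' x =
   quad (t *\<^sub>R H + (1 - t) *\<^sub>R H') (t *\<^sub>R c + (1 - t) *\<^sub>R c') (t * d + (1 - t) * d') x"
  by (simp add: quad_def matrix_vector_mult_add_rdistrib scaleR_matrix_vector_assoc[symmetric]
      inner_add_right inner_add_left) (simp add: field_simps)

lemma continuous_quad: "continuous_on UNIV (quad H c d)"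
  unfolding quad_def
  by (intro continuous_intros matrix_vector_mult_linear_continuous_on) simp

text \<open>
  Along the segment from \<open>x\<close> to \<open>y\<close> the function is a one-variable quadratic polynomial whose
  derivative vanishes at both ends, hence everywhere.
\<close>

lemma quad_eq_at_critical_points:
  assumes sym: "transpose H = H"
    and "(H *v x + c) \<bullet> (y - x) = 0" "(H *v y + c) \<bullet> (y - x) = 0"
  shows "quad H c d y = quad H c d x"
proof -
  have "H *v (y - x) = (H *v y + c) - (H *v x + c)"
    by (simp add: matrix_vector_mult_diff_distrib)
  then have "(y - x) \<bullet> (H *v (y - x)) = (H *v y + c) \<bullet> (y - x) - (H *v x + c) \<bullet> (y - x)"
    by (metis inner_commute inner_diff_left)
  then show ?thesis
    using quad_expand[OF sym, of c d x "y - x"] assms(2,3) by simp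
qed

section \<open>Critical values of a pencil of quadratic functions\<close>

text \<open>
  Let \<open>q\<^sub>t = t q1 + (1 - t) q2\<close>. The derivative of \<open>q\<^sub>t (\<xi> t)\<close> at \<open>s\<close> is
  \<open>q1 (\<xi> s) - q2 (\<xi> s)\<close> plus the derivative of \<open>q\<^sub>s\<close> in the direction of \<open>\<xi>\<close>. The first term
  vanishes because the two functions agree at \<open>\<xi> s\<close>, the second because \<open>\<xi> s\<close> is critical for
  the directions in which the curve moves. The proof computes the difference quotient with the
  exact second-order expansion of \<open>q\<^sub>s\<close> at \<open>\<xi> s\<close>.
\<close>

lemma critical_value_derivative_zero:
  fixes \<xi> :: "real \<Rightarrow> real ^ 'n"
  assumes sym: "transpose H1 = H1" "transpose H2 = H2"
    and diff: "\<And>k. (\<lambda>t. \<xi> t $ k) differentiable (at s)"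
    and crit: "\<forall>\<^sub>F t in at s.
      (s *\<^sub>R (H1 *v \<xi> s + c1) + (1 - s) *\<^sub>R (H2 *v \<xi> s + c2)) \<bullet> (\<xi> t - \<xi> s) = 0"
    and eq: "quad H1 c1 d1 (\<xi> s) = quad H2 c2 d2 (\<xi> s)"
  shows "((\<lambda>t. t * quad H1 c1 d1 (\<xi> t) + (1 - t) * quad H2 c2 d2 (\<xi> t))
    has_real_derivative 0) (at s)"
proof -
  let ?G = "\<lambda>t. t * quad H1 c1 d1 (\<xi> t) + (1 - t) * quad H2 c2 d2 (\<xi> t)"
  let ?h = "\<lambda>x. quad H1 c1 d1 x - quad H2 c2 d2 x"
  define K where "K = s *\<^sub>R H1 + (1 - s) *\<^sub>R H2"
  define e where "e = (\<lambda>t. \<xi> t - \<xi> s)"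
  have "\<exists>D. \<forall>k. ((\<lambda>t. \<xi> t $ k) has_real_derivative D k) (at s)"
    using diff unfolding real_differentiable_def by metis
  then obtain D where D: "\<And>k. ((\<lambda>t. \<xi> t $ k) has_real_derivative D k) (at s)" by blast
  have slope: "((\<lambda>t. (1 / (t - s)) *\<^sub>R e t) \<longlongrightarrow> (\<chi> k. D k)) (at s)"
  proof (rule vec_tendstoI)
    fix k
    show "((\<lambda>t. ((1 / (t - s)) *\<^sub>R e t) $ k) \<longlongrightarrow> (\<chi> k. D k) $ k) (at s)"
      using D[of k] unfolding has_field_derivative_iff e_def by simp
  qed
  have \<xi>: "(\<xi> \<longlongrightarrow> \<xi> s) (at s)"
  proof (rule vec_tendstoI)
    fix k
    show "((\<lambda>t. \<xi> t $ k) \<longlongrightarrow> \<xi> s $ k) (at s)"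
      using DERIV_isCont[OF D[of k]] by (simp add: isCont_def)
  qed
  then have e: "(e \<longlongrightarrow> 0) (at s)"
    unfolding e_def by (simp add: LIM_zero)
  have h: "((\<lambda>t. ?h (\<xi> t)) \<longlongrightarrow> 0) (at s)"
  proof -
    have "isCont ?h (\<xi> s)"
      using continuous_quad by (intro isCont_diff) (auto simp: continuous_on_eq_continuous_at)
    from isCont_tendsto_compose[OF this \<xi>] show ?thesis by (simp add: eq)
  qed
  have "((\<lambda>t. ((1 / (t - s)) *\<^sub>R e t) \<bullet> (K *v e t) / 2 + ?h (\<xi> t))
      \<longlongrightarrow> (\<chi> k. D k) \<bullet> (K *v 0) / 2 + 0) (at s)"
    by (intro tendsto_intros slope h
        bounded_linear.tendsto[OF matrix_vector_mul_bounded_linear] e) auto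
  moreover have "\<forall>\<^sub>F t in at s.
      ((1 / (t - s)) *\<^sub>R e t) \<bullet> (K *v e t) / 2 + ?h (\<xi> t) = (?G t - ?G s) / (t - s)"
    using crit eventually_neq_at_within[of s s]
  proof eventually_elim
    case (elim t)
    have symK: "transpose K = K"
      unfolding K_def using sym by (simp add: transpose_add transpose_scalar)
    have "K *v \<xi> s + (s *\<^sub>R c1 + (1 - s) *\<^sub>R c2) =
        s *\<^sub>R (H1 *v \<xi> s + c1) + (1 - s) *\<^sub>R (H2 *v \<xi> s + c2)"
      unfolding K_def
      by (simp add: matrix_vector_mult_add_rdistrib scaleR_matrix_vector_assoc[symmetric]
          scaleR_add_right)
    with elim(1) have "(K *v \<xi> s + (s *\<^sub>R c1 + (1 - s) *\<^sub>R c2)) \<bullet> e t = 0"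
      by (simp add: e_def)
    then have "s * quad H1 c1 d1 (\<xi> t) + (1 - s) * quad H2 c2 d2 (\<xi> t) =
        ?G s + e t \<bullet> (K *v e t) / 2"
      using quad_expand[OF symK, of "s *\<^sub>R c1 + (1 - s) *\<^sub>R c2" "s * d1 + (1 - s) * d2" "\<xi> s" "e t"]
      unfolding quad_pencil K_def by (simp add: e_def)
    then have G: "?G t - ?G s = e t \<bullet> (K *v e t) / 2 + (t - s) * ?h (\<xi> t)"
      by (simp add: algebra_simps)
    show ?case unfolding G using elim(2) by (simp add: add_divide_distrib)
  qed
  ultimately show ?thesis
    unfolding has_field_derivative_iff by (auto elim: Lim_transform_eventually)
qed

text \<open>
  The set \<open>S t\<close> below consists of the points that are critical for the member \<open>t\<close> of the pencil
  on the affine set of the constraints, \<open>g t\<close> is the value there, and \<open>\<Lambda>\<close> collects the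
  parameters that have a critical point at which both quadratic functions agree. The values in
  question are values of \<open>g\<close> on \<open>\<Lambda>\<close>. When \<open>\<Lambda>\<close> is infinite, \<open>g\<close> is rational with derivative
  zero at all but finitely many points of \<open>\<Lambda>\<close>.
\<close>

lemma finite_pencil_critical_values:
  fixes a :: "'i \<Rightarrow> real ^ 'n"
  assumes "finite I" and sym: "transpose H1 = H1" "transpose H2 = H2"
  shows "finite {quad H1 c1 d1 x | x t.
    (\<forall>i\<in>I. a i \<bullet> x = b i) \<and> quad H1 c1 d1 x = quad H2 c2 d2 x \<and>
    (\<forall>v. (\<forall>i\<in>I. a i \<bullet> v = 0) \<longrightarrow>
      (t *\<^sub>R (H1 *v x + c1) + (1 - t) *\<^sub>R (H2 *v x + c2)) \<bullet> v = 0)}" (is "finite ?values")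
proof -
  define V where "V = {v. \<forall>i\<in>I. a i \<bullet> v = 0}"
  define H where "H = (\<lambda>t. t *\<^sub>R H1 + (1 - t) *\<^sub>R H2)"
  define c where "c = (\<lambda>t. t *\<^sub>R c1 + (1 - t) *\<^sub>R c2)"
  define q where "q = (\<lambda>t x. t * quad H1 c1 d1 x + (1 - t) * quad H2 c2 d2 x)"
  have q_quad: "q t = quad (H t) (c t) (t * d1 + (1 - t) * d2)" for t
    unfolding q_def H_def c_def quad_pencil ..
  have grad: "H t *v x + c t = t *\<^sub>R (H1 *v x + c1) + (1 - t) *\<^sub>R (H2 *v x + c2)" for t x
    unfolding H_def c_def
    by (simp add: matrix_vector_mult_add_rdistrib scaleR_matrix_vector_assoc[symmetric]
        scaleR_add_right)
  have symH: "transpose (H t) = H t" for t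
    unfolding H_def using sym by (simp add: transpose_add transpose_scalar)
  define S where "S = (\<lambda>t. {x. (\<forall>i\<in>I. a i \<bullet> x = b i) \<and> (\<forall>v\<in>V. (H t *v x + c t) \<bullet> v = 0)})"
  have diff_V: "y - x \<in> V" if "x \<in> S t" "y \<in> S t'" for x y t t'
    using that unfolding S_def V_def by (simp add: inner_diff_right)
  \<comment> \<open>if \<open>S t\<close> is empty, then \<open>g t\<close> is an arbitrary number; this can matter at finitely many \<open>t\<close> only\<close>
  define g where "g = (\<lambda>t. q t (SOME x. x \<in> S t))"
  have g: "q t x = g t" if x: "x \<in> S t" for t x
  proof -
    define y where "y = (SOME x. x \<in> S t)"
    have y: "y \<in> S t" unfolding y_def using x by (rule someI)
    have "x - y \<in> V" using diff_V[OF y x] .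
    then have "q t x = q t y"
      unfolding q_quad using x y
      by (intro quad_eq_at_critical_points symH) (auto simp: S_def)
    then show ?thesis by (simp add: g_def y_def)
  qed
  define \<Lambda> where "\<Lambda> = {t. \<exists>x\<in>S t. quad H1 c1 d1 x = quad H2 c2 d2 x}"
  have "?values \<subseteq> g ` \<Lambda>"
  proof
    fix y assume "y \<in> ?values"
    then obtain x t where y: "y = quad H1 c1 d1 x" and eq: "quad H1 c1 d1 x = quad H2 c2 d2 x"
      and x: "x \<in> S t"
      unfolding S_def V_def grad by blast
    have "y = g t" using g[OF x] eq by (simp add: y q_def algebra_simps)
    moreover have "t \<in> \<Lambda>" using x eq unfolding \<Lambda>_def by blast
    ultimately show "y \<in> g ` \<Lambda>" by blast
  qed
  moreover have "finite (g ` \<Lambda>)"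
  proof (cases "finite \<Lambda>")
    case inf: False
    have "subspace V"
      unfolding V_def by (auto simp: subspace_def inner_add_right)
    then obtain B where B: "finite B" "B \<subseteq> V" "span B = V"
      using basis_subspace_exists by metis
    \<comment> \<open>orthogonality to \<open>V\<close> is tested on the finite spanning set \<open>B\<close>; since \<open>H t\<close> is symmetric, each test is a linear equation for \<open>x\<close>\<close>
    define E where "E = (\<lambda>i. (\<lambda>_. a i, \<lambda>_. b i)) ` I \<union>
      (\<lambda>v. (\<lambda>t. H t *v v, \<lambda>t. - (c t \<bullet> v))) ` B"
    have critical_iff: "(\<forall>v\<in>V. y \<bullet> v = 0) \<longleftrightarrow> (\<forall>v\<in>B. y \<bullet> v = 0)" for y
      using B orthogonal_to_span[of _ B y] unfolding orthogonal_def by blast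
    have S: "S t = {x. \<forall>(a, b)\<in>E. a t \<bullet> x = b t}" for t
    proof -
      have "(H t *v x + c t) \<bullet> v = 0 \<longleftrightarrow> (H t *v v) \<bullet> x = - (c t \<bullet> v)" for x v
        using symmetric_inner_commute[OF symH, of x t v]
        by (auto simp: inner_add_left inner_commute[of "H t *v v"])
      then show ?thesis unfolding S_def critical_iff E_def by (auto simp: ball_Un)
    qed
    have "finite E" unfolding E_def using assms(1) B(1) by simp
    moreover have "almost_rational (\<lambda>t. a t $ k)" if "(a, b) \<in> E" for a b k
      using that unfolding E_def H_def
      by (auto simp: matrix_vector_mult_add_rdistrib scaleR_matrix_vector_assoc[symmetric]
          intro!: almost_rational_intros)
    moreover have "almost_rational b" if "(a, b) \<in> E" for a b
    proof -
      have "almost_rational (\<lambda>t. - (c t \<bullet> v))" for v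
        unfolding c_def inner_add_left inner_scaleR_left minus_diff_eq
        using almost_rational_diff[OF almost_rational_const[of 0],
            of "\<lambda>t. t * (c1 \<bullet> v) + (1 - t) * (c2 \<bullet> v)"]
        by (simp add: almost_rational_intros)
      with that show ?thesis unfolding E_def by auto
    qed
    ultimately have "(\<forall>\<^sub>F t in cofinite. S t = {}) \<or>
      (\<exists>(w :: real \<Rightarrow> real ^ 'n) (P :: real \<Rightarrow> real ^ 'n ^ 'n).
        (\<forall>i. almost_rational (\<lambda>t. w t $ i)) \<and> (\<forall>i k. almost_rational (\<lambda>t. P t $ i $ k)) \<and>
        (\<forall>\<^sub>F t in cofinite. S t = range (\<lambda>z. w t + P t *v z)))"
      unfolding S by (rule solution_set_parametrization)
    moreover have "\<not> (\<forall>\<^sub>F t in cofinite. S t = {})"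
    proof
      assume "\<forall>\<^sub>F t in cofinite. S t = {}"
      then have "\<forall>\<^sub>F t in cofinite. t \<notin> \<Lambda>"
        by eventually_elim (simp add: \<Lambda>_def)
      with inf show False by (simp add: eventually_cofinite)
    qed
    ultimately obtain w and P :: "real \<Rightarrow> real ^ 'n ^ 'n"
      where w: "\<And>i. almost_rational (\<lambda>t. w t $ i)"
      and P: "\<And>i k. almost_rational (\<lambda>t. P t $ i $ k)"
      and par: "\<forall>\<^sub>F t in cofinite. S t = range (\<lambda>z. w t + P t *v z)"
      by blast
    have "almost_rational g"
    proof -
      have "almost_rational (\<lambda>t. quad H c d (w t))" for H c d
        unfolding quad_def
        by (intro almost_rational_intros almost_rational_inner w)
          (simp add: matrix_vector_mult_def, intro almost_rational_intros w)
      then have "almost_rational (\<lambda>t. q t (w t))"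
        unfolding q_def by (intro almost_rational_intros)
      moreover have "\<forall>\<^sub>F t in cofinite. g t = q t (w t)"
        using par
      proof eventually_elim
        case (elim t)
        have "w t + P t *v 0 \<in> S t" unfolding elim by (rule rangeI)
        from g[OF this] show ?case by simp
      qed
      ultimately show ?thesis by (rule almost_rational_cong)
    qed
    moreover have "infinite {s. (g has_real_derivative 0) (at s)}"
    proof -
      have "\<forall>\<^sub>F s in cofinite. \<forall>i. (\<lambda>t. w t $ i) differentiable (at s)"
        by (intro eventually_all_finite almost_rational_differentiable w)
      moreover have "\<forall>\<^sub>F s in cofinite. \<forall>i. \<forall>k. (\<lambda>t. P t $ i $ k) differentiable (at s)"
        by (intro eventually_all_finite almost_rational_differentiable P)
      ultimately have "\<forall>\<^sub>F s in cofinite. s \<in> \<Lambda> \<longrightarrow> (g has_real_derivative 0) (at s)"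
        using par
      proof eventually_elim
        case (elim s)
        show ?case
        proof
          assume "s \<in> \<Lambda>"
          then obtain x where x: "x \<in> S s" and eq: "quad H1 c1 d1 x = quad H2 c2 d2 x"
            unfolding \<Lambda>_def by blast
          then obtain z where z: "x = w s + P s *v z" unfolding elim by blast
          \<comment> \<open>with \<open>z\<close> frozen, the parametrization gives a curve of critical points through \<open>x\<close>\<close>
          define \<xi> where "\<xi> = (\<lambda>t. w t + P t *v z)"
          have \<xi>s: "\<xi> s = x" by (simp add: \<xi>_def z)
          have near: "\<forall>\<^sub>F t in at s. \<xi> t \<in> S t"
            using eventually_cofinite_at[OF par] by eventually_elim (auto simp: \<xi>_def)
          have "((\<lambda>t. q t (\<xi> t)) has_real_derivative 0) (at s)"
            unfolding q_def
          proof (rule critical_value_derivative_zero[OF sym])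
            show "(\<lambda>t. \<xi> t $ k) differentiable (at s)" for k
              unfolding \<xi>_def matrix_vector_mult_def vector_add_component vec_lambda_beta
              using elim by (intro differentiable_add differentiable_sum differentiable_mult) auto
            show "quad H1 c1 d1 (\<xi> s) = quad H2 c2 d2 (\<xi> s)" using eq by (simp add: \<xi>s)
            show "\<forall>\<^sub>F t in at s. (s *\<^sub>R (H1 *v \<xi> s + c1) + (1 - s) *\<^sub>R (H2 *v \<xi> s + c2)) \<bullet>
                (\<xi> t - \<xi> s) = 0"
              using near
            proof eventually_elim
              case (elim t)
              then show ?case using diff_V[OF x] x unfolding \<xi>s grad[symmetric] S_def by auto
            qed
          qed
          moreover have "\<forall>\<^sub>F t in at s. q t (\<xi> t) = g t"
            using near by eventually_elim (rule g)
          ultimately show "(g has_real_derivative 0) (at s)"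
            using has_field_derivative_cong_eventually[of "\<lambda>t. q t (\<xi> t)" g s UNIV] g[OF x] \<xi>s
            by simp
        qed
      qed
      then have "finite {s. \<not> (s \<in> \<Lambda> \<longrightarrow> (g has_real_derivative 0) (at s))}"
        by (simp only: eventually_cofinite)
      moreover have "\<Lambda> \<subseteq> {s. \<not> (s \<in> \<Lambda> \<longrightarrow> (g has_real_derivative 0) (at s))} \<union>
          {s. (g has_real_derivative 0) (at s)}"
        by blast
      ultimately show ?thesis using inf by (meson finite_UnI finite_subset)
    qed
    ultimately obtain k where "\<forall>\<^sub>F t in cofinite. g t = k"
      using almost_rational_constant by blast
    then have "finite {t. g t \<noteq> k}" by (simp add: eventually_cofinite)
    moreover have "g ` \<Lambda> \<subseteq> insert k (g ` {t. g t \<noteq> k})" by auto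
    ultimately show ?thesis by (meson finite_imageI finite_insert finite_subset)
  qed simp
  ultimately show ?thesis by (rule finite_subset)
qed

section \<open>From d-stationarity to criticality along a face\<close>

text \<open>
  The maximum of the two quadratic functions touches \<open>\<psi>\<close> at \<open>x\<close> from above, so its difference
  quotients at \<open>x\<close> dominate those of \<open>\<psi>\<close>, and its directional derivative is the right-hand side.
\<close>

lemma dir_derivative_le_max_quad:
  fixes x u :: "real ^ 'n"
  assumes L: "has_dir_derivative \<psi> L x u"
    and sym: "transpose H1 = H1" "transpose H2 = H2"
    and above: "\<forall>\<^sub>F z in nhds x. \<psi> z \<le> max (quad H1 c1 d1 z) (quad H2 c2 d2 z)"
    and touch: "quad H1 c1 d1 x = \<psi> x" "quad H2 c2 d2 x = \<psi> x"
  shows "L \<le> max ((H1 *v x + c1) \<bullet> u) ((H2 *v x + c2) \<bullet> u)"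
proof -
  let ?p = "(H1 *v x + c1) \<bullet> u" and ?r = "(H2 *v x + c2) \<bullet> u"
  let ?m = "\<lambda>\<delta>. max (?p + \<delta> * (u \<bullet> (H1 *v u) / 2)) (?r + \<delta> * (u \<bullet> (H2 *v u) / 2))"
  have "(?m \<longlongrightarrow> max (?p + 0 * (u \<bullet> (H1 *v u) / 2)) (?r + 0 * (u \<bullet> (H2 *v u) / 2))) (at_right 0)"
    by (intro tendsto_intros)
  then have lim: "(?m \<longlongrightarrow> max ?p ?r) (at_right 0)" by simp
  have "((\<lambda>\<delta>. x + \<delta> *\<^sub>R u) \<longlongrightarrow> x + 0 *\<^sub>R u) (at_right 0)"
    by (intro tendsto_intros)
  then have "filterlim (\<lambda>\<delta>. x + \<delta> *\<^sub>R u) (nhds x) (at_right 0)" by simp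
  from eventually_compose_filterlim[OF above this]
  have "\<forall>\<^sub>F \<delta> in at_right 0. (\<psi> (x + \<delta> *\<^sub>R u) - \<psi> x) / \<delta> \<le> ?m \<delta>"
    using eventually_at_right_less[of 0]
  proof eventually_elim
    case (elim \<delta>)
    have "quad H1 c1 d1 (x + \<delta> *\<^sub>R u) = \<psi> x + \<delta> * (?p + \<delta> * (u \<bullet> (H1 *v u) / 2))"
      by (simp add: quad_expand[OF sym(1)] touch matrix_vector_mult_scaleR algebra_simps)
    moreover have "quad H2 c2 d2 (x + \<delta> *\<^sub>R u) = \<psi> x + \<delta> * (?r + \<delta> * (u \<bullet> (H2 *v u) / 2))"
      by (simp add: quad_expand[OF sym(2)] touch matrix_vector_mult_scaleR algebra_simps)
    ultimately have "\<psi> (x + \<delta> *\<^sub>R u) - \<psi> x \<le> \<delta> * ?m \<delta>"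
      using elim by (simp add: max_mult_distrib_left max_def split: if_splits)
    then show ?case using elim(2) by (simp add: divide_le_eq mult.commute)
  qed
  from tendsto_le[OF trivial_limit_at_right_real lim L[unfolded has_dir_derivative_def] this]
  show ?thesis .
qed

text \<open>
  Where the functionals \<open>p\<close> and \<open>r\<close> agree on \<open>V\<close>, the hypothesis for \<open>v\<close> and \<open>- v\<close> forces both to
  be zero. So \<open>p\<close> vanishes on the kernel of \<open>p - r\<close> in \<open>V\<close> and is therefore a multiple
  \<open>s (p - r)\<close> of it on \<open>V\<close>, that is, \<open>(1 - s) p + s r = 0\<close> on \<open>V\<close>. Here \<open>t\<close> is an
  arbitrary real number, which is all that the pencil argument asks for.
\<close>

lemma affine_combination_orthogonal:
  fixes p r :: "'a :: real_inner"
  assumes V: "subspace V" and nonneg: "\<And>v. v \<in> V \<Longrightarrow> 0 \<le> max (p \<bullet> v) (r \<bullet> v)"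
  shows "\<exists>t. \<forall>v\<in>V. (t *\<^sub>R p + (1 - t) *\<^sub>R r) \<bullet> v = 0"
proof -
  have kernel: "p \<bullet> v = 0" if "v \<in> V" "p \<bullet> v = r \<bullet> v" for v
    using nonneg[OF that(1)] nonneg[OF subspace_neg[OF V that(1)]] that(2) by simp
  show ?thesis
  proof (cases "\<forall>v\<in>V. p \<bullet> v = r \<bullet> v")
    case True
    then show ?thesis using kernel by (intro exI[of _ 1]) simp
  next
    case False
    then obtain u where u: "u \<in> V" "(p - r) \<bullet> u \<noteq> 0" by (auto simp: inner_diff_left)
    define s where "s = (p \<bullet> u) / ((p - r) \<bullet> u)"
    have "((1 - s) *\<^sub>R p + (1 - (1 - s)) *\<^sub>R r) \<bullet> v = 0" if v: "v \<in> V" for v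
    proof -
      \<comment> \<open>the component of \<open>v\<close> in the kernel of \<open>p - r\<close>\<close>
      define y where "y = v - (((p - r) \<bullet> v) / ((p - r) \<bullet> u)) *\<^sub>R u"
      have "y \<in> V" unfolding y_def using V u v by (intro subspace_diff subspace_mul)
      moreover have "(p - r) \<bullet> y = 0" using u(2) by (simp add: y_def inner_diff_right)
      ultimately have "p \<bullet> y = 0" by (intro kernel) (auto simp: inner_diff_left)
      then have "p \<bullet> v = ((p - r) \<bullet> v) * s" by (simp add: y_def s_def inner_diff_right)
      then show ?thesis by (simp add: inner_add_left inner_diff_left algebra_simps)
    qed
    then show ?thesis by blast
  qed
qed

lemma polyhedron_feasible_step:
  fixes a :: "nat \<Rightarrow> 'a :: real_inner"
  assumes x: "\<forall>i<m. a i \<bullet> x \<le> b i" and v: "\<forall>i<m. a i \<bullet> x = b i \<longrightarrow> a i \<bullet> v = 0"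
  shows "\<exists>\<epsilon>>0. \<forall>i<m. a i \<bullet> (x + \<epsilon> *\<^sub>R v) \<le> b i"
proof -
  have "\<forall>\<^sub>F \<epsilon> in at_right 0. a i \<bullet> (x + \<epsilon> *\<^sub>R v) \<le> b i" if i: "i < m" for i
  proof (cases "a i \<bullet> x = b i")
    case True
    then show ?thesis using v i by (simp add: inner_add_right)
  next
    case False
    have "((\<lambda>\<epsilon>. a i \<bullet> (x + \<epsilon> *\<^sub>R v)) \<longlongrightarrow> a i \<bullet> (x + 0 *\<^sub>R v)) (at_right 0)"
      by (intro tendsto_intros)
    moreover have "a i \<bullet> (x + 0 *\<^sub>R v) < b i" using False x i by (simp add: less_le)
    ultimately have "\<forall>\<^sub>F \<epsilon> in at_right 0. a i \<bullet> (x + \<epsilon> *\<^sub>R v) < b i" by (rule order_tendstoD)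
    then show ?thesis by eventually_elim simp
  qed
  then have "\<forall>\<^sub>F \<epsilon> in at_right 0. \<forall>i\<in>{..<m}. a i \<bullet> (x + \<epsilon> *\<^sub>R v) \<le> b i"
    by (intro eventually_ball_finite) auto
  with eventually_at_right_less[of "0::real"]
  have "\<forall>\<^sub>F \<epsilon> in at_right 0. 0 < \<epsilon> \<and> (\<forall>i\<in>{..<m}. a i \<bullet> (x + \<epsilon> *\<^sub>R v) \<le> b i)"
    by (rule eventually_conj)
  then show ?thesis
    using eventually_happens'[OF trivial_limit_at_right_real] by fastforce
qed

text \<open>
  Directions along which the tight constraints stay tight are feasible with both signs for small
  steps, which makes the feasible directions contain a whole subspace.
\<close>

lemma d_stationary_imp_pencil_critical:
  fixes a :: "nat \<Rightarrow> real ^ 'n"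
  assumes stat: "x \<in> d_stationary_points \<psi> {x. \<forall>i<m. a i \<bullet> x \<le> b i}"
    and sym: "transpose H1 = H1" "transpose H2 = H2"
    and above: "\<forall>\<^sub>F z in nhds x. \<psi> z \<le> max (quad H1 c1 d1 z) (quad H2 c2 d2 z)"
    and touch: "quad H1 c1 d1 x = \<psi> x" "quad H2 c2 d2 x = \<psi> x"
  shows "\<exists>t. \<forall>v. (\<forall>i\<in>{i. i < m \<and> a i \<bullet> x = b i}. a i \<bullet> v = 0) \<longrightarrow>
    (t *\<^sub>R (H1 *v x + c1) + (1 - t) *\<^sub>R (H2 *v x + c2)) \<bullet> v = 0"
proof -
  define V where "V = {v. \<forall>i\<in>{i. i < m \<and> a i \<bullet> x = b i}. a i \<bullet> v = 0}"
  have "subspace V"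
    unfolding V_def by (auto simp: subspace_def inner_add_right)
  moreover have "0 \<le> max ((H1 *v x + c1) \<bullet> v) ((H2 *v x + c2) \<bullet> v)" if v: "v \<in> V" for v
  proof -
    have "\<forall>i<m. a i \<bullet> x \<le> b i" using stat by (simp add: d_stationary_points_def)
    then obtain \<epsilon> where \<epsilon>: "\<epsilon> > 0" "\<forall>i<m. a i \<bullet> (x + \<epsilon> *\<^sub>R v) \<le> b i"
      using polyhedron_feasible_step[of m a x b v] v by (auto simp: V_def)
    then obtain L where "L \<ge> 0" "has_dir_derivative \<psi> L x (\<epsilon> *\<^sub>R v)"
      using stat unfolding d_stationary_points_def by force
    then have "0 \<le> max ((H1 *v x + c1) \<bullet> (\<epsilon> *\<^sub>R v)) ((H2 *v x + c2) \<bullet> (\<epsilon> *\<^sub>R v))"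
      using dir_derivative_le_max_quad[OF _ sym above touch] by force
    then show ?thesis using \<epsilon>(1) by (simp add: le_max_iff_disj zero_le_mult_iff)
  qed
  ultimately show ?thesis
    using affine_combination_orthogonal[of V "H1 *v x + c1" "H2 *v x + c2"]
    unfolding V_def by blast
qed

lemma eventually_Max_le_of_argmax:
  fixes f :: "'i \<Rightarrow> 'a :: t2_space \<Rightarrow> real"
  assumes "finite A" and cont: "\<And>k. k \<in> A \<Longrightarrow> isCont (f k) x"
    and arg: "argmax_set (\<lambda>k. f k x) A = {i, i'}"
  shows "\<forall>\<^sub>F z in nhds x. (MAX k\<in>A. f k z) \<le> max (f i z) (f i' z)"
proof -
  have arg_iff: "k \<in> {i, i'} \<longleftrightarrow> k \<in> A \<and> (\<forall>l\<in>A. f l x \<le> f k x)" for k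
    unfolding arg[symmetric] argmax_set_def by (auto simp: is_arg_max_linorder)
  have i: "i \<in> A" "\<And>l. l \<in> A \<Longrightarrow> f l x \<le> f i x" using arg_iff[of i] by auto
  have "\<forall>\<^sub>F z in nhds x. f k z \<le> max (f i z) (f i' z)" if k: "k \<in> A" for k
  proof (cases "k \<in> {i, i'}")
    case True
    then show ?thesis by auto
  next
    case False
    then have "f k x < f i x"
      using arg_iff[of k] k i by (meson leI order_trans)
    moreover have "((\<lambda>z. f i z - f k z) \<longlongrightarrow> f i x - f k x) (nhds x)"
      using cont[OF k] cont[OF i(1)] unfolding isCont_def
      by (intro tendsto_diff) (auto simp: tendsto_nhds_iff)
    ultimately have "\<forall>\<^sub>F z in nhds x. 0 < f i z - f k z" by (intro order_tendstoD) auto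
    then show ?thesis by eventually_elim auto
  qed
  then have "\<forall>\<^sub>F z in nhds x. \<forall>k\<in>A. f k z \<le> max (f i z) (f i' z)"
    using \<open>finite A\<close> by (intro eventually_ball_finite) auto
  then show ?thesis
  proof eventually_elim
    case (elim z)
    then show ?case using \<open>finite A\<close> i(1) by (intro Max.boundedI) auto
  qed
qed

lemma card_le_2_obtain:
  assumes "finite S" "S \<noteq> {}" "card S \<le> 2"
  obtains i i' where "S = {i, i'}"
proof -
  have "card S = 1 \<or> card S = 2" using assms by (cases "card S") auto
  then show ?thesis using that by (metis card_1_singletonE card_2_iff insert_absorb2)
qed

theorem proposition8:
  fixes X :: "(real ^ 'n) set"
    and k1 k2 :: nat
    and \<psi>1 \<psi>2 :: "nat \<Rightarrow> real ^ 'n \<Rightarrow> real"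
    and \<psi> :: "real ^ 'n \<Rightarrow> real"
  assumes "polyhedron X"
    and "k1 \<ge> 1" and "k2 \<ge> 1"
    and "\<And>i. i \<in> {1..k1} \<Longrightarrow> quadratic_function (\<psi>1 i)"
    and "\<And>j. j \<in> {1..k2} \<Longrightarrow> quadratic_function (\<psi>2 j)"
    and "\<And>x. \<psi> x = (MAX i\<in>{1..k1}. \<psi>1 i x) - (MAX j\<in>{1..k2}. \<psi>2 j x)"
  shows "finite (\<psi> ` {x \<in> d_stationary_points \<psi> X. card (argmax_set (\<lambda>i. \<psi>1 i x) {1..k1}) \<le> 2})"
proof -
  obtain m a b where X: "X = {x. \<forall>i<(m::nat). a i \<bullet> x \<le> b i}"
    using assms(1) unfolding polyhedron_iff_linear_system by blast
  have "\<forall>i. \<exists>H c d. i \<in> {1..k1} \<longrightarrow> transpose H = H \<and> \<psi>1 i = quad H c d"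
    using assms(4) quadratic_function_imp_quad by blast
  then obtain H1 c1 d1 where \<psi>1: "\<And>i. i \<in> {1..k1} \<Longrightarrow>
      transpose (H1 i) = H1 i \<and> \<psi>1 i = quad (H1 i) (c1 i) (d1 i)"
    by metis
  have "\<forall>j. \<exists>H c d. j \<in> {1..k2} \<longrightarrow> transpose H = H \<and> \<psi>2 j = quad H c d"
    using assms(5) quadratic_function_imp_quad by blast
  then obtain H2 c2 d2 where \<psi>2: "\<And>j. j \<in> {1..k2} \<Longrightarrow>
      transpose (H2 j) = H2 j \<and> \<psi>2 j = quad (H2 j) (c2 j) (d2 j)"
    by metis
  define H where "H = (\<lambda>i j. H1 i - H2 j)"
  define c where "c = (\<lambda>i j. c1 i - c2 j)"
  define d where "d = (\<lambda>i j. d1 i - d2 j)"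
  have symH: "transpose (H i j) = H i j" if "i \<in> {1..k1}" "j \<in> {1..k2}" for i j
    unfolding H_def transpose_diff using \<psi>1[OF that(1)] \<psi>2[OF that(2)] by simp
  have diff: "quad (H i j) (c i j) (d i j) z = \<psi>1 i z - \<psi>2 j z"
    if "i \<in> {1..k1}" "j \<in> {1..k2}" for i j z
    unfolding H_def c_def d_def using \<psi>1[OF that(1)] \<psi>2[OF that(2)] by (simp add: quad_diff)
  \<comment> \<open>what a choice of tight constraints \<open>I\<close>, active pieces \<open>i\<close>, \<open>i'\<close> and subtracted piece \<open>j\<close> can contribute\<close>
  define T where "T = (\<lambda>I i i' j. {quad (H i j) (c i j) (d i j) x | x t.
    (\<forall>k\<in>I. a k \<bullet> x = b k) \<and>
    quad (H i j) (c i j) (d i j) x = quad (H i' j) (c i' j) (d i' j) x \<and>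
    (\<forall>v. (\<forall>k\<in>I. a k \<bullet> v = 0) \<longrightarrow>
      (t *\<^sub>R (H i j *v x + c i j) + (1 - t) *\<^sub>R (H i' j *v x + c i' j)) \<bullet> v = 0)})"
  let ?U = "\<Union>I\<in>Pow {..<m}. \<Union>i\<in>{1..k1}. \<Union>i'\<in>{1..k1}. \<Union>j\<in>{1..k2}. T I i i' j"
  have "finite (T I i i' j)"
    if "I \<in> Pow {..<m}" "i \<in> {1..k1}" "i' \<in> {1..k1}" "j \<in> {1..k2}" for I i i' j
    unfolding T_def using that
    by (intro finite_pencil_critical_values symH) (auto intro: finite_subset)
  then have "finite ?U" by (intro finite_UN_I) auto
  moreover have "\<psi> ` {x \<in> d_stationary_points \<psi> X.
      card (argmax_set (\<lambda>i. \<psi>1 i x) {1..k1}) \<le> 2} \<subseteq> ?U"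
  proof (intro image_subsetI)
    fix x
    assume "x \<in> {x \<in> d_stationary_points \<psi> X. card (argmax_set (\<lambda>i. \<psi>1 i x) {1..k1}) \<le> 2}"
    then have stat: "x \<in> d_stationary_points \<psi> X"
      and card: "card (argmax_set (\<lambda>i. \<psi>1 i x) {1..k1}) \<le> 2" by auto
    let ?A = "argmax_set (\<lambda>i. \<psi>1 i x) {1..k1}"
    have A_iff: "i \<in> ?A \<longleftrightarrow> i \<in> {1..k1} \<and> \<psi>1 i x = (MAX i\<in>{1..k1}. \<psi>1 i x)" for i
      unfolding argmax_set_def using assms(2)
      by (auto simp: is_arg_max_linorder intro!: antisym Max_ge Max.boundedI)
    have "(MAX i\<in>{1..k1}. \<psi>1 i x) \<in> (\<lambda>i. \<psi>1 i x) ` {1..k1}"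
      using assms(2) by (intro Max_in) auto
    then have "?A \<noteq> {}" using A_iff by (metis (no_types, lifting) empty_iff imageE)
    moreover have "finite ?A" by (rule finite_subset[of _ "{1..k1}"]) (use A_iff in auto)
    ultimately obtain i i' where A: "?A = {i, i'}" using card by (metis card_le_2_obtain)
    then have i: "i \<in> {1..k1}" "\<psi>1 i x = (MAX i\<in>{1..k1}. \<psi>1 i x)"
      and i': "i' \<in> {1..k1}" "\<psi>1 i' x = (MAX i\<in>{1..k1}. \<psi>1 i x)"
      using A_iff[of i] A_iff[of i'] by auto
    have "(MAX j\<in>{1..k2}. \<psi>2 j x) \<in> (\<lambda>j. \<psi>2 j x) ` {1..k2}"
      using assms(3) by (intro Max_in) auto
    then obtain j where j: "j \<in> {1..k2}" "\<psi>2 j x = (MAX j\<in>{1..k2}. \<psi>2 j x)" by auto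
    have touch: "quad (H i j) (c i j) (d i j) x = \<psi> x" "quad (H i' j) (c i' j) (d i' j) x = \<psi> x"
      using i i' j assms(6) by (simp_all add: diff)
    have "\<forall>\<^sub>F z in nhds x. (MAX k\<in>{1..k1}. \<psi>1 k z) \<le> max (\<psi>1 i z) (\<psi>1 i' z)"
    proof (rule eventually_Max_le_of_argmax[where f = \<psi>1, OF _ _ A])
      show "isCont (\<psi>1 k) x" if "k \<in> {1..k1}" for k
        using \<psi>1[OF that] continuous_quad by (auto simp: continuous_on_eq_continuous_at)
    qed simp
    then have above: "\<forall>\<^sub>F z in nhds x. \<psi> z \<le>
        max (quad (H i j) (c i j) (d i j) z) (quad (H i' j) (c i' j) (d i' j) z)"
    proof eventually_elim
      case (elim z)
      \<comment> \<open>one active piece of the subtracted maximum suffices, because it bounds \<open>\<psi>\<close> from above\<close>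
      have "\<psi>2 j z \<le> (MAX j\<in>{1..k2}. \<psi>2 j z)" using j(1) by (intro Max_ge) auto
      with elim show ?case
        unfolding assms(6) diff[OF i(1) j(1)] diff[OF i'(1) j(1)] by (auto simp: max_def)
    qed
    define I where "I = {k. k < m \<and> a k \<bullet> x = b k}"
    obtain t where "\<forall>v. (\<forall>k\<in>I. a k \<bullet> v = 0) \<longrightarrow>
        (t *\<^sub>R (H i j *v x + c i j) + (1 - t) *\<^sub>R (H i' j *v x + c i' j)) \<bullet> v = 0"
      using d_stationary_imp_pencil_critical[OF stat[unfolded X] symH[OF i(1) j(1)]
          symH[OF i'(1) j(1)] above touch]
      unfolding I_def by blast
    moreover have "\<forall>k\<in>I. a k \<bullet> x = b k" by (simp add: I_def)
    ultimately have "\<psi> x \<in> T I i i' j"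
      unfolding T_def using touch by (intro CollectI exI[of _ x] exI[of _ t]) auto
    moreover have "I \<in> Pow {..<m}" by (auto simp: I_def)
    ultimately show "\<psi> x \<in> ?U" using i(1) i'(1) j(1) by blast
  qed
  ultimately show ?thesis by (rule finite_subset[rotated])
qed

end
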